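(* Assume that there exists $K_L>0$ with $\Vert\boldsymbol{\Lambda}(x)-\boldsymbol{\Lambda}(y)\Vert\le K_L|x-y|$ for all $x,y\ge0$. Then for any $q>1$ and $\varepsilon>0$ there exists a constant $\kappa_L(q,\varepsilon)$ such that for all $T\ge0$, as $n\to\infty$, $$\mathbb{P}\left(\sup_{0\le s<t\le T}\Vert\boldsymbol{P}^{(n)}(s,t)-\widehat{\boldsymbol{P}}^{(n)}(s,t)\Vert\ge(T+1)\kappa_L(q,\varepsilon)(\log n)n^{-1/2+\varepsilon}\right)=o(n^{-q}),$$ $$\mathbb{P}\left(\sup_{0\le s<t\le T}\Vert\boldsymbol{P}^{(n)}(s,t)-\widetilde{\boldsymbol{P}}^{(n)}(s,t)\Vert\ge(T+1)\kappa_L(q,\varepsilon)(\log n)n^{-1/2+\varepsilon}\right)=o(n^{-q}).$$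
   Context: Let $p\ge1$, $\mathcal{E}=\{1,\dots,p\}$, and let $\boldsymbol{\Lambda}(t)=\{\Lambda_{ij}(t)\}_{i,j\in\mathcal{E}}$, $t\ge0$, be an intensity matrix function: Borel measurable, integrable over compact intervals, with $\Lambda_{ii}(t)\le0$, $\Lambda_{ij}(t)\ge0$ for $i\ne j$, and $\sum_j\Lambda_{ij}(t)\le0$. Standing assumption: $\sup_{i\in\mathcal{E},t\ge0}|\Lambda_{ii}(t)|<\infty$. Let $\lambda_0=\lceil\sup_{i,t}|\Lambda_{ii}(t)|\rceil$ (positive, as it is a Poisson intensity). $\Vert\cdot\Vert$ denotes the supremum norm of matrices. On a probability space $(\Omega,\mathcal{F},\mathbb{P})$ let $\mathcal{N}$ be a Poisson process of intensity $\lambda_0$ and $\{\widehat{\mathcal{N}}^{(k)}\}_{k\ge\lambda_0+1}$ Poisson processes of intensity $1$, all independent. For $n\ge\lambda_0$ let $\mathcal{N}^{(n)}$ be the superposition of $\mathcal{N},\widehat{\mathcal{N}}^{(\lambda_0+1)},\dots,\widehat{\mathcal{N}}^{(n)}$ (a Poisson process of intensity $n$), with arrival times $\{\chi^{(n)}_\ell\}_{\ell\ge0}$, $\chi^{(n)}_0=0$. Define, for $\ell\ge1$, $\boldsymbol{Q}^{(n)}_\ell=\boldsymbol{I}+\frac1n\boldsymbol{\Lambda}(\chi^{(n)}_\ell)$ (random), $\widehat{\boldsymbol{Q}}^{(n)}_\ell=\boldsymbol{I}+\frac1n\boldsymbol{\Lambda}(\ell/n)$ and $\widetilde{\boldsymbol{Q}}^{(n)}_\ell=\boldsymbol{I}+\frac1n\mathbb{E}[\boldsymbol{\Lambda}(\chi^{(n)}_\ell)]$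 (deterministic). With $\mathrm{Poi}_\lambda(m)=\frac{\lambda^m}{m!}e^{-\lambda}$ and empty products equal to the identity, for $0\le s\le t$ set $$\boldsymbol{P}^{(n)}(s,t)=\sum_{\ell=0}^\infty\sum_{k=0}^\infty\mathrm{Poi}_{ns}(k)\,\mathrm{Poi}_{n(t-s)}(\ell)\,\boldsymbol{Q}^{(n)}_{k+1}\cdots\boldsymbol{Q}^{(n)}_{k+\ell},$$ and let $\widehat{\boldsymbol{P}}^{(n)}(s,t)$ and $\widetilde{\boldsymbol{P}}^{(n)}(s,t)$ be given by the same double series with $\boldsymbol{Q}^{(n)}$ replaced by $\widehat{\boldsymbol{Q}}^{(n)}$ and $\widetilde{\boldsymbol{Q}}^{(n)}$ respectively. *)

theory Defs
  imports "HOL-Probability.Probability"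
begin

text \<open>
  The state space is the finite (hence nonempty) index type \<open>'p\<close>, with \<open>p = CARD('p)\<close>.
  Rows come first: \<open>A $ i $ j\<close> is the entry in row \<open>i\<close> and column \<open>j\<close>.
\<close>

definition sup_norm :: "real^'p^'p \<Rightarrow> real" where
  "sup_norm A = (MAX (i, j) \<in> UNIV. \<bar>A $ i $ j\<bar>)"

definition intensity_matrix_function :: "(real \<Rightarrow> real^'p^'p) \<Rightarrow> bool" where
  "intensity_matrix_function \<Lambda> \<longleftrightarrow>
     \<Lambda> \<in> borel_measurable (restrict_space borel {0..}) \<and>
     (\<forall>a b. 0 \<le> a \<longrightarrow> a \<le> b \<longrightarrow> set_integrable lborel {a..b} \<Lambda>) \<and>
     (\<forall>t\<ge>0. \<forall>i. \<Lambda> t $ i $ i \<le> 0) \<and>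
     (\<forall>t\<ge>0. \<forall>i j. i \<noteq> j \<longrightarrow> 0 \<le> \<Lambda> t $ i $ j) \<and>
     (\<forall>t\<ge>0. \<forall>i. (\<Sum>j\<in>UNIV. \<Lambda> t $ i $ j) \<le> 0)"

definition exit_rates :: "(real \<Rightarrow> real^'p^'p) \<Rightarrow> real set" where
  "exit_rates \<Lambda> = {\<bar>\<Lambda> t $ i $ i\<bar> | i t. 0 \<le> t}"

definition base_rate :: "(real \<Rightarrow> real^'p^'p) \<Rightarrow> nat" where
  "base_rate \<Lambda> = nat \<lceil>Sup (exit_rates \<Lambda>)\<rceil>"

text \<open>
  \<open>poisson_pmf\<close> is only specified for positive rates, whereas rate 0 (point mass at 0) occurs
  below for \<open>s = 0\<close>.
\<close>

definition Poi :: "real \<Rightarrow> nat \<Rightarrow> real" where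
  "Poi r m = r ^ m / fact m * exp (- r)"

text \<open>
  A Poisson process is represented by its counting process, of which only times \<open>t \<ge> 0\<close> matter.
  Paths are nondecreasing and right-continuous for every outcome, so the natural number
  subtraction in the increments does not truncate.
\<close>

definition poisson_process :: "'a measure \<Rightarrow> real \<Rightarrow> (real \<Rightarrow> 'a \<Rightarrow> nat) \<Rightarrow> bool" where
  "poisson_process M r X \<longleftrightarrow>
     (\<forall>t\<ge>0. X t \<in> measurable M (count_space UNIV)) \<and>
     (\<forall>\<omega>\<in>space M. X 0 \<omega> = 0 \<and> mono_on {0..} (\<lambda>t. X t \<omega>) \<and>
        (\<forall>t\<ge>0. continuous (at_right t) (\<lambda>u. X u \<omega>))) \<and>
     (\<forall>(\<tau> :: nat \<Rightarrow> real) m. 0 \<le> \<tau> 0 \<longrightarrow> mono \<tau> \<longrightarrow>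
        prob_space.indep_vars M (\<lambda>_. count_space UNIV)
          (\<lambda>i \<omega>. X (\<tau> (Suc i)) \<omega> - X (\<tau> i) \<omega>) {..<m}) \<and>
     (\<forall>s t m. 0 \<le> s \<longrightarrow> s \<le> t \<longrightarrow>
        measure M {\<omega> \<in> space M. X t \<omega> - X s \<omega> = m} = Poi (r * (t - s)) m)"

text \<open>
  Joint independence of whole processes, each regarded as a random element of the product
  space over all times \<open>t \<ge> 0\<close>.
\<close>

definition indep_processes ::
    "'a measure \<Rightarrow> (nat \<Rightarrow> real \<Rightarrow> 'a \<Rightarrow> nat) \<Rightarrow> nat set \<Rightarrow> bool" where
  "indep_processes M Y I \<longleftrightarrow>
     prob_space.indep_vars M (\<lambda>_. Pi\<^sub>M {0::real..} (\<lambda>_. count_space (UNIV :: nat set)))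
       (\<lambda>k \<omega>. \<lambda>t\<in>{0..}. Y k t \<omega>) I"

definition superposition ::
    "nat \<Rightarrow> (real \<Rightarrow> 'a \<Rightarrow> nat) \<Rightarrow> (nat \<Rightarrow> real \<Rightarrow> 'a \<Rightarrow> nat) \<Rightarrow> nat \<Rightarrow> real \<Rightarrow> 'a \<Rightarrow> nat" where
  "superposition l0 N N' n t \<omega> = N t \<omega> + (\<Sum>k\<in>{l0 + 1..n}. N' k t \<omega>)"

text \<open>
  The time of the \<open>l\<close>-th arrival, equal to 0 for \<open>l = 0\<close>. For a Poisson process of positive
  intensity the set is nonempty almost surely.
\<close>

definition arrival_time :: "(real \<Rightarrow> 'a \<Rightarrow> nat) \<Rightarrow> nat \<Rightarrow> 'a \<Rightarrow> real" where
  "arrival_time X l \<omega> = Inf {t. 0 \<le> t \<and> l \<le> X t \<omega>}"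

definition chi ::
    "(real \<Rightarrow> real^'p^'p) \<Rightarrow> (real \<Rightarrow> 'a \<Rightarrow> nat) \<Rightarrow> (nat \<Rightarrow> real \<Rightarrow> 'a \<Rightarrow> nat) \<Rightarrow>
     nat \<Rightarrow> nat \<Rightarrow> 'a \<Rightarrow> real" where
  "chi \<Lambda> N N' n = arrival_time (superposition (base_rate \<Lambda>) N N' n)"

text \<open>\<open>mat_prod Q k l\<close> is the product of \<open>Q (k + 1), \<dots>, Q (k + l)\<close>, in this order.\<close>

primrec mat_prod :: "(nat \<Rightarrow> real^'p^'p) \<Rightarrow> nat \<Rightarrow> nat \<Rightarrow> real^'p^'p" where
  "mat_prod Q k 0 = mat 1"
| "mat_prod Q k (Suc l) = mat_prod Q k l ** Q (k + Suc l)"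

definition poisson_series :: "nat \<Rightarrow> (nat \<Rightarrow> real^'p^'p) \<Rightarrow> real \<Rightarrow> real \<Rightarrow> real^'p^'p" where
  "poisson_series n Q s t =
     (\<Sum>l. \<Sum>k. (Poi (real n * s) k * Poi (real n * (t - s)) l) *\<^sub>R mat_prod Q k l)"

definition P_random ::
    "(real \<Rightarrow> real^'p^'p) \<Rightarrow> (real \<Rightarrow> 'a \<Rightarrow> nat) \<Rightarrow> (nat \<Rightarrow> real \<Rightarrow> 'a \<Rightarrow> nat) \<Rightarrow>
     nat \<Rightarrow> 'a \<Rightarrow> real \<Rightarrow> real \<Rightarrow> real^'p^'p" where
  "P_random \<Lambda> N N' n \<omega> =
     poisson_series n (\<lambda>l. mat 1 + (1 / real n) *\<^sub>R \<Lambda> (chi \<Lambda> N N' n l \<omega>))"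

definition P_hat :: "(real \<Rightarrow> real^'p^'p) \<Rightarrow> nat \<Rightarrow> real \<Rightarrow> real \<Rightarrow> real^'p^'p" where
  "P_hat \<Lambda> n = poisson_series n (\<lambda>l. mat 1 + (1 / real n) *\<^sub>R \<Lambda> (real l / real n))"

definition P_tilde ::
    "'a measure \<Rightarrow> (real \<Rightarrow> real^'p^'p) \<Rightarrow> (real \<Rightarrow> 'a \<Rightarrow> nat) \<Rightarrow>
     (nat \<Rightarrow> real \<Rightarrow> 'a \<Rightarrow> nat) \<Rightarrow> nat \<Rightarrow> real \<Rightarrow> real \<Rightarrow> real^'p^'p" where
  "P_tilde M \<Lambda> N N' n =
     poisson_series n
       (\<lambda>l. mat 1 + (1 / real n) *\<^sub>R (\<integral>\<omega>. \<Lambda> (chi \<Lambda> N N' n l \<omega>) \<partial>M))"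

text \<open>
  The supremum is taken in the extended reals, because for \<open>T = 0\<close> there are no admissible
  pairs and the real supremum of the empty set is unspecified.
\<close>

definition sup_dist ::
    "real \<Rightarrow> (real \<Rightarrow> real \<Rightarrow> real^'p^'p) \<Rightarrow> (real \<Rightarrow> real \<Rightarrow> real^'p^'p) \<Rightarrow> ereal" where
  "sup_dist T A B =
     (SUP (s, t) \<in> {(s, t). 0 \<le> s \<and> s < t \<and> t \<le> T}. ereal (sup_norm (A s t - B s t)))"

end

theory Submission
  imports Defs "HOL-Real_Asymp.Real_Asymp"
begin

text \<open>
  All three families of matrices are the same double Poisson average of products
  \<open>(I + A\<^sub>k\<^sub>+\<^sub>1 / n) \<dots> (I + A\<^sub>k\<^sub>+\<^sub>l / n)\<close>; only the bounded sequence \<open>A\<close> differs. It is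
  \<open>\<Lambda>\<close> at the arrival times, \<open>\<Lambda>\<close> at the mean arrival times \<open>j / n\<close>, or the expectation of the first.
  Two facts carry the proof.

  The average is stable (\<open>poisson_series_diff_le\<close>): if \<open>norm (A j - B j) \<le> \<eta> (1 + j / n)\<close> for
  every \<open>j\<close>, then the two averages differ by at most a constant times \<open>\<eta>\<close>, uniformly in
  \<open>s \<le> t \<le> T\<close> and in \<open>n\<close>. Telescoping bounds the difference of two products of \<open>l\<close> factors
  by \<open>\<eta>\<close> times a polynomial and an exponential of \<open>m / n\<close>, where \<open>m = k + l\<close>. The whole is at most
  a constant times \<open>\<eta> exp (\<alpha> m / n)\<close>, and under the averaging \<open>m\<close> is Poisson distributed with
  mean \<open>n t\<close>, so that this exponential has expectation
  \<open>exp (n t (exp (\<alpha> / n) - 1))\<close>, which is bounded in \<open>n\<close>. The error may grow linearly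
  in \<open>j / n\<close>, so that this one estimate also covers the tails of the Poisson weights.

  The arrival times concentrate (\<open>prob_deviates_le\<close>): the \<open>j\<close>-th arrival time of a Poisson
  process of rate \<open>n\<close> is farther than \<open>(1 + j / n) n powr (\<delta> - 1 / 2)\<close> from \<open>j / n\<close> with
  probability at most \<open>2 exp (2 - n powr \<delta>)\<close>, once \<open>n powr \<delta> \<ge> 2\<close>. This is the exponential Markov inequality for the
  number of arrivals at a fixed time, with parameter \<open>n powr (- 1 / 2)\<close>. The bound is uniform
  in \<open>j\<close> and decays faster than every power of \<open>n\<close>, hence so does the bound for the union over
  \<open>j \<le> n\<^sup>2\<close>. For \<open>j > n\<^sup>2\<close> the allowed error is at least 1, and boundedness of \<open>\<Lambda>\<close>
  suffices (\<open>prob_large_sup_dist_le\<close>).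

  With \<open>\<delta> = min \<epsilon> (1 / 2)\<close> and the Lipschitz condition, the distance between the averages is at most
  a constant times \<open>n powr (\<delta> - 1 / 2)\<close> outside an event of negligible probability. The constant
  depends on \<open>T\<close> but is eventually dominated by \<open>ln n\<close>, so that \<open>\<kappa> = 1\<close> serves for all
  parameters. For the deterministic sequence of expectations, the same concentration bound, integrated,
  shows that it is as close to \<open>\<Lambda> (j / n)\<close> as the random sequence typically is
  (\<open>expectation_near_mean\<close>).
\<close>

section \<open>Perturbation of products and of their Poisson averages\<close>

lemma matrix_mult_norm_bound:
  "\<exists>K>0. \<forall>(A :: real^'p^'p) (B :: real^'p^'p). norm (A ** B) \<le> K * norm A * norm B"
proof -
  have "bounded_bilinear ((**) :: real^'p^'p \<Rightarrow> real^'p^'p \<Rightarrow> real^'p^'p)"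
    unfolding bilinear_conv_bounded_bilinear[symmetric] bilinear_def
    by (auto intro!: linearI simp: matrix_scalar_ac scalar_matrix_assoc vec_eq_iff
        matrix_matrix_mult_def sum.distrib[symmetric] algebra_simps sum_distrib_left)
  then obtain K where "K > 0" "\<And>(A :: real^'p^'p) (B :: real^'p^'p). norm (A ** B) \<le> norm A * norm B * K"
    using bounded_bilinear.pos_bounded by blast
  then show ?thesis by (auto simp: mult_ac)
qed

lemma sup_norm_le_norm: "sup_norm (A :: real^'p^'p) \<le> norm A"
proof -
  have "\<bar>A $ i $ j\<bar> \<le> norm A" for i j
    by (meson component_le_norm_cart Finite_Cartesian_Product.norm_nth_le order_trans)
  then show ?thesis
    unfolding sup_norm_def by (subst Max_le_iff) auto
qed

lemma norm_le_sum_entries: "norm (A :: real^'p^'p) \<le> (\<Sum>i\<in>UNIV. \<Sum>j\<in>UNIV. \<bar>A $ i $ j\<bar>)"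
proof -
  have "norm A \<le> (\<Sum>i\<in>UNIV. norm (A $ i))"
    by (simp add: norm_vec_def L2_set_le_sum)
  also have "\<dots> \<le> (\<Sum>i\<in>UNIV. \<Sum>j\<in>UNIV. \<bar>A $ i $ j\<bar>)"
    by (intro sum_mono norm_le_l1_cart)
  finally show ?thesis .
qed

lemma norm_le_sup_norm: "norm (A :: real^'p^'p) \<le> (real CARD('p))\<^sup>2 * sup_norm A"
proof -
  have "\<bar>A $ i $ j\<bar> \<le> sup_norm A" for i j
    unfolding sup_norm_def by (rule Max_ge) force+
  then have "(\<Sum>i\<in>UNIV. \<Sum>j\<in>UNIV. \<bar>A $ i $ j\<bar>)
      \<le> (\<Sum>i\<in>(UNIV :: 'p set). \<Sum>j\<in>(UNIV :: 'p set). sup_norm A)"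
    by (intro sum_mono)
  then show ?thesis
    using norm_le_sum_entries[of A] by (simp add: power2_eq_square mult_ac)
qed

lemma norm_mat_prod_le:
  fixes A :: "nat \<Rightarrow> real^'p^'p"
  assumes mult: "\<And>(A :: real^'p^'p) (B :: real^'p^'p). norm (A ** B) \<le> K * norm A * norm B" and "0 \<le> K"
    and A: "\<And>j. norm (A j) \<le> c"
  shows "norm (mat_prod (\<lambda>j. mat 1 + A j) k l) \<le> norm (mat 1 :: real^'p^'p) * (1 + K * c) ^ l"
proof (induction l)
  case (Suc l)
  define P where "P = mat_prod (\<lambda>j. mat 1 + A j) k l"
  have "norm (P ** (mat 1 + A (k + Suc l))) \<le> norm P + norm (P ** A (k + Suc l))"
    by (simp add: matrix_add_ldistrib norm_triangle_ineq)
  also have "norm (P ** A (k + Suc l)) \<le> K * norm P * c"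
    using mult[of P "A (k + Suc l)"] mult_left_mono[OF A[of "k + Suc l"], of "K * norm P"] \<open>0 \<le> K\<close>
    by simp
  also have "norm P + K * norm P * c = norm P * (1 + K * c)"
    by (simp add: algebra_simps)
  also have "\<dots> \<le> norm (mat 1 :: real^'p^'p) * (1 + K * c) ^ l * (1 + K * c)"
    using Suc order_trans[OF norm_ge_zero A] \<open>0 \<le> K\<close> by (intro mult_right_mono) (auto simp: P_def)
  finally show ?case by (simp add: P_def mult_ac)
qed simp

text \<open>
  Telescoping: replacing one factor at a time leaves on both sides of the replaced factor a product
  of factors of size at most \<open>1 + K c\<close>.
\<close>

lemma norm_mat_prod_diff_le:
  fixes A B :: "nat \<Rightarrow> real^'p^'p"
  assumes mult: "\<And>(A :: real^'p^'p) (B :: real^'p^'p). norm (A ** B) \<le> K * norm A * norm B" and "0 \<le> K"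
    and A: "\<And>j. norm (A j) \<le> c" and B: "\<And>j. norm (B j) \<le> c"
    and d: "\<And>j. norm (A j - B j) \<le> d j"
  shows "norm (mat_prod (\<lambda>j. mat 1 + A j) k l - mat_prod (\<lambda>j. mat 1 + B j) k l)
    \<le> norm (mat 1 :: real^'p^'p) * K * (1 + K * c) ^ l * (\<Sum>i<l. d (k + Suc i))"
proof (induction l)
  case (Suc l)
  define P where "P = mat_prod (\<lambda>j. mat 1 + A j) k l"
  define R where "R = mat_prod (\<lambda>j. mat 1 + B j) k l"
  define j where "j = k + Suc l"
  define w where "w = norm (mat 1 :: real^'p^'p)"
  define S where "S = (\<Sum>i<l. d (k + Suc i))"
  have c: "0 \<le> c" and dj: "0 \<le> d j" using order_trans[OF norm_ge_zero A] order_trans[OF norm_ge_zero d] by auto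
  have R: "norm R \<le> w * (1 + K * c) ^ l"
    unfolding R_def w_def by (rule norm_mat_prod_le[OF mult \<open>0 \<le> K\<close> B])
  have "P ** (mat 1 + A j) - R ** (mat 1 + B j) = (P - R) + (P - R) ** A j + R ** (A j - B j)"
    unfolding matrix_add_ldistrib matrix_mul_rid
    by (simp add: vec_eq_iff matrix_matrix_mult_def sum.distrib[symmetric]
        sum_subtractf[symmetric] algebra_simps)
  also have "norm \<dots> \<le> norm (P - R) + norm ((P - R) ** A j) + norm (R ** (A j - B j))"
    by (intro norm_triangle_le add_mono order_refl norm_triangle_ineq)
  also have "norm ((P - R) ** A j) \<le> K * norm (P - R) * c"
    by (intro order_trans[OF mult] mult_left_mono A) (use \<open>0 \<le> K\<close> in auto)
  also have "norm (R ** (A j - B j)) \<le> K * norm R * d j"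
    by (intro order_trans[OF mult] mult_left_mono d) (use \<open>0 \<le> K\<close> in auto)
  also have "norm (P - R) + K * norm (P - R) * c + K * norm R * d j
      = norm (P - R) * (1 + K * c) + norm R * (K * d j)"
    by (simp add: algebra_simps)
  also have "\<dots> \<le> w * K * (1 + K * c) ^ l * S * (1 + K * c) + w * (1 + K * c) ^ l * (K * d j)"
    using Suc R c dj \<open>0 \<le> K\<close> unfolding P_def R_def w_def S_def
    by (intro add_mono mult_right_mono) auto
  also have "w * (1 + K * c) ^ l * (K * d j) \<le> w * (1 + K * c) ^ Suc l * (K * d j)"
    using c dj \<open>0 \<le> K\<close> by (intro mult_right_mono mult_left_mono power_increasing) (auto simp: w_def)
  finally show ?case
    by (simp add: P_def R_def S_def w_def j_def algebra_simps)
qed simp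

lemma Poi_nonneg: "0 \<le> r \<Longrightarrow> 0 \<le> Poi r k"
  by (simp add: Poi_def)

lemma Poi_generating_function: "(\<lambda>k. Poi r k * z ^ k) sums exp (r * (z - 1))"
proof -
  have "(\<lambda>k. exp (- r) * ((r * z) ^ k /\<^sub>R fact k)) sums (exp (- r) * exp (r * z))"
    by (intro sums_mult exp_converges)
  then show ?thesis
    by (simp add: Poi_def power_mult_distrib field_simps exp_add[symmetric] exp_diff exp_minus)
qed

text \<open>
  Geometric growth in the averaged quantity is the bound that is preserved by averaging, since
  averages of powers are given by the generating function. It is therefore used for both summations
  of the double series in turn.
\<close>

lemma Poi_average_bound:
  fixes f :: "nat \<Rightarrow> 'b::banach"
  assumes "0 \<le> r" and f: "\<And>k. norm (f k) \<le> B * z ^ k"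
  shows "summable (\<lambda>k. Poi r k *\<^sub>R f k)"
    and "norm (\<Sum>k. Poi r k *\<^sub>R f k) \<le> B * exp (r * (z - 1))"
proof -
  have sums: "(\<lambda>k. B * (Poi r k * z ^ k)) sums (B * exp (r * (z - 1)))"
    by (intro sums_mult Poi_generating_function)
  have le: "norm (Poi r k *\<^sub>R f k) \<le> B * (Poi r k * z ^ k)" for k
    using mult_left_mono[OF f[of k] Poi_nonneg[OF assms(1), of k]]
      Poi_nonneg[OF assms(1), of k] by (simp add: mult_ac)
  have *: "summable (\<lambda>k. norm (Poi r k *\<^sub>R f k))"
    by (rule summable_comparison_test'[OF sums_summable[OF sums]]) (use le in auto)
  then show "summable (\<lambda>k. Poi r k *\<^sub>R f k)" by (rule summable_norm_cancel)
  have "norm (\<Sum>k. Poi r k *\<^sub>R f k) \<le> (\<Sum>k. norm (Poi r k *\<^sub>R f k))"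
    by (rule summable_norm[OF *])
  also have "\<dots> \<le> (\<Sum>k. B * (Poi r k * z ^ k))"
    by (rule suminf_le[OF le * sums_summable[OF sums]])
  finally show "norm (\<Sum>k. Poi r k *\<^sub>R f k) \<le> B * exp (r * (z - 1))"
    using sums by (simp add: sums_iff)
qed

lemma double_Poi_average_diff:
  fixes F G :: "nat \<Rightarrow> nat \<Rightarrow> 'b::banach"
  assumes "0 \<le> a" "0 \<le> b"
    and F: "\<And>k l. norm (F k l) \<le> B * z ^ (k + l)"
    and G: "\<And>k l. norm (G k l) \<le> B * z ^ (k + l)"
    and FG: "\<And>k l. norm (F k l - G k l) \<le> e * z ^ (k + l)"
  shows "norm ((\<Sum>l. \<Sum>k. (Poi a k * Poi b l) *\<^sub>R F k l) - (\<Sum>l. \<Sum>k. (Poi a k * Poi b l) *\<^sub>R G k l))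
    \<le> e * exp ((a + b) * (z - 1))"
proof -
  define V where "V H l = (\<Sum>k. Poi a k *\<^sub>R H k l)" for H :: "nat \<Rightarrow> nat \<Rightarrow> 'b" and l
  have inner: "summable (\<lambda>k. Poi a k *\<^sub>R H k l)"
      "norm (V H l) \<le> C * exp (a * (z - 1)) * z ^ l"
    if "\<And>k l. norm (H k l) \<le> C * z ^ (k + l)" for H C l
    using Poi_average_bound[OF \<open>0 \<le> a\<close>, of "\<lambda>k. H k l" "C * z ^ l" z] that
    by (auto simp: V_def power_add mult_ac)
  have out: "(\<Sum>k. (Poi a k * Poi b l) *\<^sub>R H k l) = Poi b l *\<^sub>R V H l"
    if "\<And>k l. norm (H k l) \<le> C * z ^ (k + l)" for H C l
    using suminf_scaleR_right[OF inner(1)[OF that], of "Poi b l" l]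
    by (simp add: V_def mult.commute)
  have V_diff: "V F l - V G l = V (\<lambda>k l. F k l - G k l) l" for l
    unfolding V_def
    by (subst suminf_diff[OF inner(1)[OF F] inner(1)[OF G]]) (simp add: scaleR_diff_right)
  have "(\<Sum>l. Poi b l *\<^sub>R V F l) - (\<Sum>l. Poi b l *\<^sub>R V G l)
      = (\<Sum>l. Poi b l *\<^sub>R V (\<lambda>k l. F k l - G k l) l)"
    by (subst suminf_diff[OF Poi_average_bound(1)[OF \<open>0 \<le> b\<close> inner(2)[OF F]]
          Poi_average_bound(1)[OF \<open>0 \<le> b\<close> inner(2)[OF G]]])
       (simp add: scaleR_diff_right[symmetric] V_diff)
  also have "norm \<dots> \<le> e * exp (a * (z - 1)) * exp (b * (z - 1))"
    by (rule Poi_average_bound(2)[OF \<open>0 \<le> b\<close> inner(2)[OF FG]])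
  finally show ?thesis
    by (simp add: out[OF F] out[OF G] exp_add[symmetric] algebra_simps)
qed

text \<open>
  The constant depends neither on \<open>n\<close> nor on \<open>s\<close> and \<open>t\<close>: for \<open>z = exp (\<alpha> / n)\<close> the
  generating function of the total count, with mean \<open>n t\<close>, is \<open>exp (t n (z - 1))\<close>, and
  \<open>n (z - 1)\<close> stays bounded. In \<open>\<alpha> = K C + 1\<close>, the summand \<open>K C\<close> pays for the size of the
  products and the summand 1 for the accumulated differences.
\<close>

lemma poisson_series_diff_le:
  fixes C T :: real
  shows "\<exists>\<Gamma>\<ge>0. \<forall>n\<ge>1. \<forall>(A :: nat \<Rightarrow> real^'p^'p) B \<eta> s t. 0 \<le> s \<longrightarrow> s \<le> t \<longrightarrow> t \<le> T \<longrightarrow>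
     (\<forall>j. norm (A j) \<le> C) \<longrightarrow> (\<forall>j. norm (B j) \<le> C) \<longrightarrow>
     (\<forall>j. norm (A j - B j) \<le> \<eta> * (1 + real j / real n)) \<longrightarrow>
     norm (poisson_series n (\<lambda>j. mat 1 + (1 / real n) *\<^sub>R A j) s t
         - poisson_series n (\<lambda>j. mat 1 + (1 / real n) *\<^sub>R B j) s t) \<le> \<Gamma> * \<eta>"
proof -
  obtain K where "K > 0" and mult: "\<And>(A :: real^'p^'p) (B :: real^'p^'p). norm (A ** B) \<le> K * norm A * norm B"
    using matrix_mult_norm_bound by metis
  define w where "w = norm (mat 1 :: real^'p^'p)"
  define \<alpha> where "\<alpha> = K * \<bar>C\<bar> + 1"
  have "\<alpha> \<ge> 1" using \<open>K > 0\<close> by (simp add: \<alpha>_def)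
  define \<Gamma> where "\<Gamma> = 2 * w * K * exp (\<bar>T\<bar> * (\<alpha> * exp \<alpha>))"
  have "\<Gamma> \<ge> 0" using \<open>K > 0\<close> by (simp add: \<Gamma>_def w_def)
  moreover
  have "norm (poisson_series n (\<lambda>j. mat 1 + (1 / real n) *\<^sub>R A j) s t
         - poisson_series n (\<lambda>j. mat 1 + (1 / real n) *\<^sub>R B j) s t) \<le> \<Gamma> * \<eta>"
    if n: "n \<ge> 1" and st: "0 \<le> s" "s \<le> t" "t \<le> T"
      and A: "\<And>j. norm (A j) \<le> C" and B: "\<And>j. norm (B j) \<le> C"
      and AB: "\<And>j. norm (A j - B j) \<le> \<eta> * (1 + real j / real n)"
    for n s t \<eta> and A B :: "nat \<Rightarrow> real^'p^'p"
  proof -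
    have "0 \<le> C" using order_trans[OF norm_ge_zero A] .
    have \<eta>: "0 \<le> \<eta>" using order_trans[OF norm_ge_zero AB[of 0]] by simp
    define z where "z = exp (\<alpha> / real n)"
    have z_power: "z ^ m = exp (\<alpha> * (real m / real n))" for m
      by (simp add: z_def exp_of_nat_mult[symmetric] mult_ac)
    have pow: "(1 + K * (C / real n)) ^ l \<le> exp (K * C * (real (k + l) / real n))" for k l
    proof -
      have "(1 + K * (C / real n)) ^ l \<le> exp (K * (C / real n)) ^ l"
        using \<open>K > 0\<close> \<open>0 \<le> C\<close> by (intro power_mono) auto
      also have "\<dots> = exp (K * C * (real l / real n))"
        by (simp add: exp_of_nat_mult[symmetric] mult_ac)
      also have "\<dots> \<le> exp (K * C * (real (k + l) / real n))"
        using \<open>K > 0\<close> \<open>0 \<le> C\<close> by (simp add: divide_right_mono mult_left_mono)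
      finally show ?thesis .
    qed
    \<comment> \<open>The first factor bounds the products, the second the weights \<open>(1 + x) * x\<close> below.\<close>
    have z_split: "z ^ m = exp (K * C * (real m / real n)) * exp (real m / real n)" for m
      using \<open>0 \<le> C\<close> by (simp add: z_power \<alpha>_def exp_add[symmetric] algebra_simps add_divide_distrib)
    have An: "norm ((1 / real n) *\<^sub>R A j) \<le> C / real n" "norm ((1 / real n) *\<^sub>R B j) \<le> C / real n" for j
      using A B n by (auto simp: divide_right_mono)
    have ABn: "norm ((1 / real n) *\<^sub>R A j - (1 / real n) *\<^sub>R B j) \<le> \<eta> * (1 + real j / real n) / real n" for j
      using AB[of j] n by (simp add: scaleR_diff_right[symmetric] divide_right_mono)
    have single: "norm (mat_prod (\<lambda>j. mat 1 + (1 / real n) *\<^sub>R H j) k l) \<le> w * z ^ (k + l)"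
      if H: "\<And>j. norm ((1 / real n) *\<^sub>R H j) \<le> C / real n" for H :: "nat \<Rightarrow> real^'p^'p" and k l
    proof -
      have "norm (mat_prod (\<lambda>j. mat 1 + (1 / real n) *\<^sub>R H j) k l) \<le> w * (1 + K * (C / real n)) ^ l"
        unfolding w_def using \<open>K > 0\<close> by (intro norm_mat_prod_le mult H) auto
      also have "\<dots> \<le> w * z ^ (k + l)"
      proof (rule mult_left_mono)
        have "exp (K * C * (real (k + l) / real n)) * 1 \<le> z ^ (k + l)"
          unfolding z_split by (intro mult_left_mono) auto
        then show "(1 + K * (C / real n)) ^ l \<le> z ^ (k + l)"
          using pow[of l k] by linarith
      qed (simp add: w_def)
      finally show ?thesis .
    qed
    have diff: "norm (mat_prod (\<lambda>j. mat 1 + (1 / real n) *\<^sub>R A j) k l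
          - mat_prod (\<lambda>j. mat 1 + (1 / real n) *\<^sub>R B j) k l) \<le> 2 * w * K * \<eta> * z ^ (k + l)" for k l
    proof -
      define x where "x = real (k + l) / real n"
      have x: "0 \<le> x" by (simp add: x_def)
      have "(\<Sum>i<l. \<eta> * (1 + real (k + Suc i) / real n) / real n)
          \<le> (\<Sum>i<l. \<eta> * (1 + x) / real n)"
        unfolding x_def using \<eta> by (intro sum_mono divide_right_mono mult_left_mono add_left_mono) auto
      also have "\<dots> = \<eta> * (1 + x) * (real l / real n)" by simp
      also have "\<dots> \<le> \<eta> * (1 + x) * x"
        unfolding x_def using \<eta> by (intro mult_left_mono divide_right_mono) auto
      also have "\<dots> \<le> \<eta> * (2 * exp x)"
      proof -
        have "(1 + x) * x \<le> 2 * (1 + x + x\<^sup>2 / 2)" using x by (simp add: power2_eq_square algebra_simps)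
        also have "\<dots> \<le> 2 * exp x" using exp_lower_Taylor_quadratic[OF x] by simp
        finally show ?thesis using \<eta> by (simp add: mult_left_mono mult.assoc)
      qed
      finally have S: "(\<Sum>i<l. \<eta> * (1 + real (k + Suc i) / real n) / real n) \<le> \<eta> * (2 * exp x)" .
      have "norm (mat_prod (\<lambda>j. mat 1 + (1 / real n) *\<^sub>R A j) k l
            - mat_prod (\<lambda>j. mat 1 + (1 / real n) *\<^sub>R B j) k l)
          \<le> w * K * (1 + K * (C / real n)) ^ l
            * (\<Sum>i<l. \<eta> * (1 + real (k + Suc i) / real n) / real n)"
        unfolding w_def using \<open>K > 0\<close> by (intro norm_mat_prod_diff_le mult An ABn) auto
      also have "\<dots> \<le> w * K * exp (K * C * x) * (\<eta> * (2 * exp x))"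
        using S pow[of l k] \<open>K > 0\<close> \<eta> \<open>0 \<le> C\<close>
        by (intro mult_mono mult_left_mono) (auto simp: w_def x_def intro!: sum_nonneg)
      also have "\<dots> = 2 * w * K * \<eta> * z ^ (k + l)"
        unfolding z_split x_def by simp
      finally show ?thesis .
    qed
    have "norm (poisson_series n (\<lambda>j. mat 1 + (1 / real n) *\<^sub>R A j) s t
         - poisson_series n (\<lambda>j. mat 1 + (1 / real n) *\<^sub>R B j) s t)
        \<le> 2 * w * K * \<eta> * exp ((real n * s + real n * (t - s)) * (z - 1))"
      unfolding poisson_series_def
      by (intro double_Poi_average_diff[where B = w] single An diff) (use st in auto)
    also have "(real n * s + real n * (t - s)) * (z - 1) = t * (real n * (z - 1))"
      by (simp add: algebra_simps)
    also have "\<dots> \<le> \<bar>T\<bar> * (\<alpha> * exp \<alpha>)"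
    proof (rule mult_mono)
      have "1 - \<alpha> / real n \<le> exp (- (\<alpha> / real n))" using exp_ge_add_one_self[of "- (\<alpha> / real n)"] by simp
      then have "z - 1 \<le> \<alpha> / real n * z"
        using mult_right_mono[of "1 - \<alpha> / real n" "exp (- (\<alpha> / real n))" z]
        by (simp add: z_def exp_add[symmetric] algebra_simps)
      then have "real n * (z - 1) \<le> \<alpha> * z" using n by (simp add: field_simps)
      also have "\<dots> \<le> \<alpha> * exp \<alpha>"
        using \<open>\<alpha> \<ge> 1\<close> n unfolding z_def by (intro mult_left_mono) (auto simp: field_simps)
      finally show "real n * (z - 1) \<le> \<alpha> * exp \<alpha>" .
    qed (use st \<open>\<alpha> \<ge> 1\<close> n in \<open>auto simp: z_def\<close>)
    then have "2 * w * K * \<eta> * exp (t * (real n * (z - 1))) \<le> \<Gamma> * \<eta>"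
      using \<eta> \<open>K > 0\<close> by (simp add: \<Gamma>_def w_def mult_ac mult_left_mono)
    finally show ?thesis .
  qed
  ultimately show ?thesis by blast
qed


section \<open>Arrival times of a counting process with Poisson marginals\<close>

lemma exp_minus_one_le:
  fixes x :: real
  assumes "\<bar>x\<bar> \<le> 1"
  shows "exp x - 1 \<le> x + x\<^sup>2"
proof (cases "0 \<le> x")
  case True then show ?thesis using exp_bound[of x] assms by simp
next
  case False
  define y where "y = - x"
  have y: "0 \<le> y" "y \<le> 1" "x = - y" using False assms by (auto simp: y_def)
  have "1 \<le> (1 - y + y\<^sup>2) * (1 + y)"
    using y by (simp add: power2_eq_square algebra_simps)
  also have "\<dots> \<le> (1 - y + y\<^sup>2) * exp y"
    using y by (intro mult_left_mono exp_ge_add_one_self) auto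
  finally have "exp (- y) \<le> 1 - y + y\<^sup>2"
    by (simp add: exp_minus field_simps)
  then show ?thesis using y by simp
qed

text \<open>
  Of a Poisson process, the concentration of arrival times uses only the marginal distributions,
  through their exponential moments, and the monotonicity of paths.
\<close>

locale poisson_counting = prob_space M for M :: "'a measure" +
  fixes X :: "real \<Rightarrow> 'a \<Rightarrow> nat" and r :: real
  assumes rate_pos: "0 < r"
    and X_measurable [measurable]: "0 \<le> t \<Longrightarrow> X t \<in> measurable M (count_space UNIV)"
    and X_mono: "\<omega> \<in> space M \<Longrightarrow> 0 \<le> s \<Longrightarrow> s \<le> t \<Longrightarrow> X s \<omega> \<le> X t \<omega>"
    and X_mgf: "0 \<le> t \<Longrightarrow>
      (\<integral>\<^sup>+\<omega>. ennreal (exp (\<theta> * real (X t \<omega>))) \<partial>M) = ennreal (exp (r * t * (exp \<theta> - 1)))"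
begin

lemma prob_ge_le:
  assumes t: "0 \<le> t" and "0 < \<theta>"
  shows "prob {\<omega> \<in> space M. j \<le> X t \<omega>} \<le> exp (r * t * (exp \<theta> - 1) - \<theta> * real j)"
proof -
  note [measurable] = X_measurable[OF t]
  have "emeasure M {\<omega> \<in> space M. real j \<le> real (X t \<omega>)}
      \<le> ennreal (exp (- \<theta> * real j))
        * (\<integral>\<^sup>+\<omega>. ennreal (exp (\<theta> * real (X t \<omega>))) * indicator (space M) \<omega> \<partial>M)"
    by (rule Chernoff_ineq_nn_integral_ge) (use \<open>0 < \<theta>\<close> in auto)
  also have "(\<integral>\<^sup>+\<omega>. ennreal (exp (\<theta> * real (X t \<omega>))) * indicator (space M) \<omega> \<partial>M)
      = ennreal (exp (r * t * (exp \<theta> - 1)))"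
    using X_mgf[OF t, of \<theta>] by (simp cong: nn_integral_cong)
  finally show ?thesis
    by (simp add: emeasure_eq_measure ennreal_mult[symmetric] exp_add[symmetric] algebra_simps)
qed

lemma prob_less_le:
  assumes t: "0 \<le> t" and "0 < \<theta>"
  shows "prob {\<omega> \<in> space M. X t \<omega> < j} \<le> exp (r * t * (exp (- \<theta>) - 1) + \<theta> * real j)"
proof -
  note [measurable] = X_measurable[OF t]
  have "emeasure M {\<omega> \<in> space M. real (X t \<omega>) \<le> real j}
      \<le> ennreal (exp (\<theta> * real j))
        * (\<integral>\<^sup>+\<omega>. ennreal (exp (- \<theta> * real (X t \<omega>))) * indicator (space M) \<omega> \<partial>M)"
    by (rule Chernoff_ineq_nn_integral_le) (use \<open>0 < \<theta>\<close> in auto)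
  also have "(\<integral>\<^sup>+\<omega>. ennreal (exp (- \<theta> * real (X t \<omega>))) * indicator (space M) \<omega> \<partial>M)
      = ennreal (exp (r * t * (exp (- \<theta>) - 1)))"
    using X_mgf[OF t, of "- \<theta>"] by (simp cong: nn_integral_cong)
  finally have "prob {\<omega> \<in> space M. X t \<omega> \<le> j} \<le> exp (r * t * (exp (- \<theta>) - 1) + \<theta> * real j)"
    by (simp add: emeasure_eq_measure ennreal_mult[symmetric] exp_add[symmetric] algebra_simps)
  moreover have "prob {\<omega> \<in> space M. X t \<omega> < j} \<le> prob {\<omega> \<in> space M. X t \<omega> \<le> j}"
    by (intro finite_measure_mono) auto
  ultimately show ?thesis by linarith
qed

text \<open>
  For fixed \<open>j\<close>, the probability of staying below \<open>j\<close> up to time \<open>m\<close> decays exponentially in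
  \<open>m\<close>. On the exceptional null set some arrival time is the infimum of the empty set, about which
  nothing is known, not even its sign.
\<close>

lemma AE_reaches_all_levels: "AE \<omega> in M. \<forall>j. \<exists>m::nat. j \<le> X (real m) \<omega>"
proof -
  have "AE \<omega> in M. \<exists>m::nat. j \<le> X (real m) \<omega>" for j
  proof -
    define B where "B = {\<omega> \<in> space M. \<forall>m::nat. X (real m) \<omega> < j}"
    have [measurable]: "X (real m) \<in> measurable M (count_space UNIV)" for m :: nat by simp
    have [measurable]: "B \<in> sets M" unfolding B_def by measurable
    define c where "c = r * (1 - exp (- 1))"
    have "c > 0" using rate_pos by (simp add: c_def)
    have "prob B \<le> exp (real j - c * real m)" for m :: nat
    proof -
      have "prob B \<le> prob {\<omega> \<in> space M. X (real m) \<omega> < j}"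
        by (intro finite_measure_mono) (auto simp: B_def)
      also have "\<dots> \<le> exp (r * real m * (exp (- 1) - 1) + 1 * real j)"
        by (rule prob_less_le) auto
      finally show ?thesis by (simp add: c_def algebra_simps)
    qed
    moreover have "(\<lambda>m. exp (real j - c * real m)) \<longlonglongrightarrow> 0"
      using \<open>c > 0\<close> by real_asymp
    ultimately have "prob B \<le> 0"
      by (intro LIMSEQ_le_const) auto
    then have "B \<in> null_sets M"
      by (simp add: null_sets_def emeasure_eq_measure measure_le_0_iff)
    then show ?thesis
      by (rule AE_I') (auto simp: B_def not_le)
  qed
  then show ?thesis by (simp add: AE_all_countable)
qed

lemma arrival_time_nonneg:
  assumes "\<exists>m::nat. j \<le> X (real m) \<omega>"
  shows "0 \<le> arrival_time X j \<omega>"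
  unfolding arrival_time_def using assms by (intro cInf_greatest) (auto intro: of_nat_0_le_iff)

lemma arrival_time_le: "0 \<le> t \<Longrightarrow> j \<le> X t \<omega> \<Longrightarrow> arrival_time X j \<omega> \<le> t"
  unfolding arrival_time_def by (rule cInf_lower) (auto intro!: bdd_belowI[of _ 0])

lemma arrival_time_ge:
  assumes \<omega>: "\<omega> \<in> space M" and "\<exists>m::nat. j \<le> X (real m) \<omega>" and "0 \<le> t" "X t \<omega> < j"
  shows "t \<le> arrival_time X j \<omega>"
  unfolding arrival_time_def
proof (rule cInf_greatest)
  show "{t. 0 \<le> t \<and> j \<le> X t \<omega>} \<noteq> {}" using assms(2) by (auto intro: of_nat_0_le_iff)
next
  fix u assume "u \<in> {t. 0 \<le> t \<and> j \<le> X t \<omega>}"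
  then show "t \<le> u" using X_mono[OF \<omega>, of u t] assms(4) by force
qed

lemma arrival_time_unreached:
  assumes \<omega>: "\<omega> \<in> space M" and never: "\<not> (\<exists>m::nat. j \<le> X (real m) \<omega>)"
  shows "arrival_time X j \<omega> = Inf {}"
proof -
  have "\<not> j \<le> X t \<omega>" if t: "0 \<le> t" for t
    using X_mono[OF \<omega> t, of "real (nat \<lceil>t\<rceil>)"] never t by (meson order_trans real_nat_ceiling_ge)
  then have "{t. 0 \<le> t \<and> j \<le> X t \<omega>} = {}" by blast
  then show ?thesis by (simp only: arrival_time_def)
qed

text \<open>
  By monotonicity of paths, level \<open>j\<close> is reached before time \<open>a\<close> iff it has been reached at some
  rational time before \<open>a\<close>. On the outcomes that never reach \<open>j\<close>, the arrival time is constant.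
\<close>

lemma arrival_time_measurable [measurable]: "arrival_time X j \<in> borel_measurable M"
proof -
  have [measurable]: "X (real m) \<in> measurable M (count_space UNIV)" for m :: nat by simp
  define R where "R = {\<omega> \<in> space M. \<exists>m::nat. j \<le> X (real m) \<omega>}"
  have [measurable]: "R \<in> sets M" unfolding R_def by measurable
  have empty: "arrival_time X j \<omega> = Inf {}" if "\<omega> \<in> space M - R" for \<omega>
    using arrival_time_unreached that by (auto simp: R_def)
  have "{\<omega> \<in> space M. arrival_time X j \<omega> < a} \<in> sets M" for a
  proof -
    have "{\<omega> \<in> R. arrival_time X j \<omega> < a}
        = R \<inter> (\<Union>q\<in>{q::rat. 0 \<le> real_of_rat q \<and> real_of_rat q < a}. {\<omega> \<in> space M. j \<le> X (real_of_rat q) \<omega>})"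
      (is "?L = ?U")
    proof (intro equalityI subsetI)
      fix \<omega> assume "\<omega> \<in> ?L"
      then have \<omega>: "\<omega> \<in> R" "\<omega> \<in> space M" "Inf {t. 0 \<le> t \<and> j \<le> X t \<omega>} < a"
        by (auto simp: R_def arrival_time_def)
      then obtain u where u: "0 \<le> u" "j \<le> X u \<omega>" "u < a"
        by (subst (asm) cInf_less_iff) (auto intro!: bdd_belowI[of _ 0] simp: R_def intro: of_nat_0_le_iff)
      obtain q where q: "u < real_of_rat q" "real_of_rat q < a" using of_rat_dense[OF \<open>u < a\<close>] by auto
      have "j \<le> X (real_of_rat q) \<omega>"
        using X_mono[OF \<omega>(2) u(1), of "real_of_rat q"] q u by linarith
      moreover have "0 \<le> real_of_rat q" using u q by linarith
      ultimately show "\<omega> \<in> ?U" using \<omega> q by auto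
    next
      fix \<omega> assume "\<omega> \<in> ?U"
      then obtain q :: rat where "\<omega> \<in> R" "0 \<le> real_of_rat q" "real_of_rat q < a" "j \<le> X (real_of_rat q) \<omega>"
        by blast
      then show "\<omega> \<in> ?L" using arrival_time_le[of "real_of_rat q" j \<omega>] by auto
    qed
    also have "\<dots> \<in> sets M"
      by (intro sets.Int sets.countable_UN'' countableI_type) (auto intro!: X_measurable)
    finally have *: "{\<omega> \<in> R. arrival_time X j \<omega> < a} \<in> sets M" .
    have "{\<omega> \<in> space M. arrival_time X j \<omega> < a}
        = {\<omega> \<in> R. arrival_time X j \<omega> < a} \<union> (if Inf {} < a then space M - R else {})"
    proof (rule set_eqI)
      fix \<omega>
      show "\<omega> \<in> {\<omega> \<in> space M. arrival_time X j \<omega> < a} \<longleftrightarrow>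
          \<omega> \<in> {\<omega> \<in> R. arrival_time X j \<omega> < a} \<union> (if Inf {} < a then space M - R else {})"
        using empty[of \<omega>] by (cases "\<omega> \<in> R") (auto simp: R_def)
    qed
    then show ?thesis using * by auto
  qed
  then show ?thesis by (simp add: borel_measurable_iff_less)
qed

text \<open>
  The standard deviation \<open>sqrt j / r\<close> of the \<open>j\<close>-th arrival time is at most
  \<open>(1 + j / r) * r powr (- 1 / 2)\<close>; the additional factor \<open>r powr \<delta>\<close> makes larger deviations
  improbable, uniformly in \<open>j\<close>.
\<close>

definition deviation :: "real \<Rightarrow> nat \<Rightarrow> real" where
  "deviation \<delta> j = (1 + real j / r) * r powr (\<delta> - 1 / 2)"

text \<open>
  The \<open>j\<close>-th arrival comes too late or too early, expressed by the counts at two fixed times.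
  It cannot be too early if the earlier of these times is negative, where \<open>X\<close> is meaningless.
\<close>

definition deviates :: "real \<Rightarrow> nat \<Rightarrow> 'a set" where
  "deviates \<delta> j =
    {\<omega> \<in> space M. X (real j / r + deviation \<delta> j) \<omega> < j} \<union>
    {\<omega> \<in> space M. 0 \<le> real j / r - deviation \<delta> j \<and> j \<le> X (real j / r - deviation \<delta> j) \<omega>}"

lemma deviation_nonneg: "0 \<le> deviation \<delta> j"
  using rate_pos by (simp add: deviation_def)

lemma deviates_sets [measurable]: "deviates \<delta> j \<in> sets M"
proof -
  have [measurable]: "X (real j / r + deviation \<delta> j) \<in> measurable M (count_space UNIV)"
    using rate_pos deviation_nonneg by (intro X_measurable) simp
  have "{\<omega> \<in> space M. 0 \<le> real j / r - deviation \<delta> j \<and> j \<le> X (real j / r - deviation \<delta> j) \<omega>} \<in> sets M"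
  proof (cases "0 \<le> real j / r - deviation \<delta> j")
    case True
    then have [measurable]: "X (real j / r - deviation \<delta> j) \<in> measurable M (count_space UNIV)" by simp
    show ?thesis by measurable
  qed simp
  then show ?thesis unfolding deviates_def by auto
qed

lemma arrival_time_near_mean:
  assumes \<omega>: "\<omega> \<in> space M" "\<exists>m::nat. j \<le> X (real m) \<omega>" and "\<omega> \<notin> deviates \<delta> j"
  shows "\<bar>arrival_time X j \<omega> - real j / r\<bar> \<le> deviation \<delta> j"
proof -
  have "arrival_time X j \<omega> \<le> real j / r + deviation \<delta> j"
    using assms rate_pos deviation_nonneg[of \<delta> j]
    by (intro arrival_time_le) (auto simp: deviates_def)
  moreover have "real j / r - deviation \<delta> j \<le> arrival_time X j \<omega>"
  proof (cases "0 \<le> real j / r - deviation \<delta> j")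
    case True
    then show ?thesis using assms by (intro arrival_time_ge) (auto simp: deviates_def)
  next
    case False
    then show ?thesis using arrival_time_nonneg[OF \<omega>(2)] by linarith
  qed
  ultimately show ?thesis by linarith
qed

text \<open>
  With \<open>h = 1 + j / r\<close> and \<open>\<theta> = r powr (- 1 / 2)\<close>, the exponent in the Markov
  bounds has a linear part \<open>- r d \<theta> = - h r powr \<delta>\<close>, and a quadratic part of at most
  \<open>2 h\<close> because \<open>r \<theta>\<^sup>2 = 1\<close> and \<open>d \<le> h\<close>; the latter uses \<open>\<delta> \<le> 1 / 2\<close>. As
  \<open>h \<ge> 1\<close>, their sum is at most \<open>2 - r powr \<delta>\<close>.
\<close>

lemma prob_deviates_le:
  assumes "1 \<le> r" "\<delta> \<le> 1 / 2" "2 \<le> r powr \<delta>"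
  shows "prob (deviates \<delta> j) \<le> 2 * exp (2 - r powr \<delta>)"
proof -
  define \<theta> where "\<theta> = r powr (- 1 / 2)"
  define h where "h = 1 + real j / r"
  define d where "d = deviation \<delta> j"
  have "\<theta> \<le> r powr 0" unfolding \<theta>_def using \<open>1 \<le> r\<close> by (intro powr_mono) auto
  then have \<theta>: "0 < \<theta>" "\<theta> \<le> 1" using rate_pos by (auto simp: \<theta>_def)
  have "\<theta> * \<theta> = r powr (- 1)" by (simp add: \<theta>_def powr_add[symmetric])
  then have \<theta>2: "r * \<theta>\<^sup>2 = 1"
    using rate_pos by (simp add: power2_eq_square powr_minus_divide)
  have "r powr (\<delta> - 1 / 2) = r powr \<delta> * \<theta>"
    by (simp add: \<theta>_def powr_add[symmetric])
  then have d: "d = h * r powr \<delta> * \<theta>" by (simp add: d_def deviation_def h_def)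
  have "d \<le> h"
  proof -
    have "r powr (\<delta> - 1 / 2) \<le> r powr 0" using assms by (intro powr_mono) auto
    then show ?thesis
      unfolding d_def deviation_def h_def using rate_pos by (intro mult_left_le) auto
  qed
  have h: "1 \<le> h" using rate_pos by (simp add: h_def)
  have dpos: "0 \<le> d" unfolding d_def by (rule deviation_nonneg)
  have j: "real j = r * (h - 1)" using rate_pos by (simp add: h_def)
  have drift: "r * d * \<theta> = h * r powr \<delta>" using \<theta>2 by (simp add: d power2_eq_square mult_ac)
  have bound: "h * (2 - r powr \<delta>) \<le> 2 - r powr \<delta>"
    using mult_right_mono_neg[OF h, of "2 - r powr \<delta>"] assms by simp
  have late: "prob {\<omega> \<in> space M. X (real j / r + d) \<omega> < j} \<le> exp (2 - r powr \<delta>)"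
  proof -
    have "r * (real j / r + d) * (exp (- \<theta>) - 1) + \<theta> * real j
        \<le> r * (real j / r + d) * (- \<theta> + \<theta>\<^sup>2) + \<theta> * real j"
      using exp_minus_one_le[of "- \<theta>"] \<theta> rate_pos dpos by (intro add_right_mono mult_left_mono) auto
    also have "\<dots> = (h - 1 + d) * (r * \<theta>\<^sup>2) - r * d * \<theta>"
      using rate_pos by (simp add: j field_simps power2_eq_square)
    also have "\<dots> \<le> h * (2 - r powr \<delta>)"
      unfolding \<theta>2 drift using \<open>d \<le> h\<close> by (simp add: algebra_simps)
    finally have "exp (r * (real j / r + d) * (exp (- \<theta>) - 1) + \<theta> * real j) \<le> exp (2 - r powr \<delta>)"
      using bound by simp
    moreover have "0 \<le> real j / r + d" using rate_pos dpos by simp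
    ultimately show ?thesis using prob_less_le[OF _ \<theta>(1)] order_trans by blast
  qed
  have early: "prob {\<omega> \<in> space M. 0 \<le> real j / r - d \<and> j \<le> X (real j / r - d) \<omega>} \<le> exp (2 - r powr \<delta>)"
  proof (cases "0 \<le> real j / r - d")
    case True
    have "r * (real j / r - d) * (exp \<theta> - 1) - \<theta> * real j
        \<le> r * (real j / r - d) * (\<theta> + \<theta>\<^sup>2) - \<theta> * real j"
      using exp_minus_one_le[of "\<theta>"] \<theta> rate_pos True by (intro diff_right_mono mult_left_mono) auto
    also have "\<dots> = (h - 1 - d) * (r * \<theta>\<^sup>2) - r * d * \<theta>"
      using rate_pos by (simp add: j field_simps power2_eq_square)
    also have "\<dots> \<le> h * (2 - r powr \<delta>)"
      unfolding \<theta>2 drift using dpos h by (simp add: algebra_simps)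
    finally have "exp (r * (real j / r - d) * (exp \<theta> - 1) - \<theta> * real j) \<le> exp (2 - r powr \<delta>)"
      using bound by simp
    then have "prob {\<omega> \<in> space M. j \<le> X (real j / r - d) \<omega>} \<le> exp (2 - r powr \<delta>)"
      using prob_ge_le[OF True \<theta>(1), of j] order_trans by blast
    then show ?thesis using True by simp
  qed simp
  have [measurable]: "X (real j / r + d) \<in> measurable M (count_space UNIV)"
    using rate_pos dpos by (intro X_measurable) simp
  have "prob (deviates \<delta> j) \<le> prob {\<omega> \<in> space M. X (real j / r + d) \<omega> < j}
      + prob {\<omega> \<in> space M. 0 \<le> real j / r - d \<and> j \<le> X (real j / r - d) \<omega>}"
    unfolding deviates_def d_def[symmetric]
  proof (intro order_trans[OF measure_Un_le] order_refl)
    show "{\<omega> \<in> space M. 0 \<le> real j / r - d \<and> j \<le> X (real j / r - d) \<omega>} \<in> events"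
      by (cases "0 \<le> real j / r - d") (auto intro!: X_measurable)
  qed measurable
  then show ?thesis using late early by linarith
qed

text \<open>
  Nothing is assumed about \<open>f\<close> on negative arguments, so the outcomes that never reach \<open>j\<close>, where
  the arrival time might be negative, are separated off; there the composition is constant.
\<close>

lemma compose_arrival_time_measurable:
  assumes f: "f \<in> borel_measurable (restrict_space borel {0..})"
  shows "(\<lambda>\<omega>. f (arrival_time X j \<omega>)) \<in> borel_measurable M"
proof -
  have [measurable]: "X (real m) \<in> measurable M (count_space UNIV)" for m :: nat by simp
  have "(\<lambda>\<omega>. max 0 (arrival_time X j \<omega>)) \<in> measurable M (restrict_space borel {0..})"
    by (intro measurable_restrict_space2) auto
  then have [measurable]: "(\<lambda>\<omega>. f (max 0 (arrival_time X j \<omega>))) \<in> borel_measurable M"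
    using f by (rule measurable_compose)
  have "(\<lambda>\<omega>. if \<exists>m::nat. j \<le> X (real m) \<omega> then f (max 0 (arrival_time X j \<omega>)) else f (Inf {}))
      \<in> borel_measurable M"
    by measurable
  then show ?thesis
    by (rule measurable_cong[THEN iffD1, rotated])
       (auto simp: arrival_time_unreached arrival_time_nonneg max_absorb2)
qed

lemma value_near_mean:
  fixes f :: "real \<Rightarrow> 'b::real_normed_vector"
  assumes lip: "\<And>x y. 0 \<le> x \<Longrightarrow> 0 \<le> y \<Longrightarrow> norm (f x - f y) \<le> K * \<bar>x - y\<bar>" and "0 \<le> K"
    and \<omega>: "\<omega> \<in> space M" "\<exists>m::nat. j \<le> X (real m) \<omega>" "\<omega> \<notin> deviates \<delta> j"
  shows "norm (f (arrival_time X j \<omega>) - f (real j / r)) \<le> K * deviation \<delta> j"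
proof -
  have "norm (f (arrival_time X j \<omega>) - f (real j / r)) \<le> K * \<bar>arrival_time X j \<omega> - real j / r\<bar>"
    using rate_pos arrival_time_nonneg[OF \<omega>(2)] by (intro lip) auto
  also have "\<dots> \<le> K * deviation \<delta> j"
    using \<open>0 \<le> K\<close> by (intro mult_left_mono arrival_time_near_mean \<omega>)
  finally show ?thesis .
qed

text \<open>
  On the event that the arrival time deviates, the integrand is bounded by \<open>2 C\<close>; elsewhere the
  Lipschitz condition applies.
\<close>

lemma expectation_near_mean:
  fixes f :: "real \<Rightarrow> 'b::{banach, second_countable_topology}"
  assumes f: "f \<in> borel_measurable (restrict_space borel {0..})"
    and C: "\<And>x. 0 \<le> x \<Longrightarrow> norm (f x) \<le> C"
    and lip: "\<And>x y. 0 \<le> x \<Longrightarrow> 0 \<le> y \<Longrightarrow> norm (f x - f y) \<le> K * \<bar>x - y\<bar>" and "0 \<le> K"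
  shows "norm (\<integral>\<omega>. f (arrival_time X j \<omega>) \<partial>M) \<le> C"
    and "norm ((\<integral>\<omega>. f (arrival_time X j \<omega>) \<partial>M) - f (real j / r))
      \<le> K * deviation \<delta> j + 2 * C * prob (deviates \<delta> j)"
proof -
  let ?g = "\<lambda>\<omega>. f (arrival_time X j \<omega>)"
  note [measurable] = compose_arrival_time_measurable[OF f, of j]
  have reach: "AE \<omega> in M. \<exists>m::nat. j \<le> X (real m) \<omega>"
    using AE_reaches_all_levels by (rule AE_mp) auto
  then have AE_C: "AE \<omega> in M. norm (?g \<omega>) \<le> C"
    by (rule AE_mp) (auto intro!: AE_I2 C arrival_time_nonneg)
  have int: "integrable M ?g"
    by (rule integrable_const_bound[OF AE_C]) measurable
  have "norm (\<integral>\<omega>. ?g \<omega> \<partial>M) \<le> (\<integral>\<omega>. norm (?g \<omega>) \<partial>M)" by (rule integral_norm_bound)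
  also have "\<dots> \<le> (\<integral>\<omega>. C \<partial>M)" by (intro integral_mono_AE integrable_norm int AE_C) auto
  finally show "norm (\<integral>\<omega>. ?g \<omega> \<partial>M) \<le> C" by (simp add: prob_space)
  have ind: "integrable M (indicator (deviates \<delta> j) :: 'a \<Rightarrow> real)"
    by (rule integrable_real_indicator) (auto simp: less_top[symmetric])
  have "(\<integral>\<omega>. ?g \<omega> \<partial>M) - f (real j / r) = (\<integral>\<omega>. ?g \<omega> - f (real j / r) \<partial>M)"
    using int by (simp add: prob_space)
  also have "norm \<dots> \<le> (\<integral>\<omega>. norm (?g \<omega> - f (real j / r)) \<partial>M)" by (rule integral_norm_bound)
  also have "\<dots> \<le> (\<integral>\<omega>. K * deviation \<delta> j + 2 * C * indicator (deviates \<delta> j) \<omega> \<partial>M)"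
  proof (rule integral_mono_AE)
    show "AE \<omega> in M. norm (?g \<omega> - f (real j / r)) \<le> K * deviation \<delta> j + 2 * C * indicator (deviates \<delta> j) \<omega>"
      using reach AE_C AE_space
    proof eventually_elim
      case (elim \<omega>)
      show ?case
      proof (cases "\<omega> \<in> deviates \<delta> j")
        case True
        have "0 \<le> real j / r" using rate_pos by simp
        have "norm (?g \<omega> - f (real j / r)) \<le> norm (?g \<omega>) + norm (f (real j / r))" by (rule norm_triangle_ineq4)
        also have "\<dots> \<le> C + C" by (intro add_mono elim C) fact
        finally have "norm (?g \<omega> - f (real j / r)) \<le> 2 * C" by simp
        moreover have "0 \<le> K * deviation \<delta> j" using \<open>0 \<le> K\<close> deviation_nonneg by simp
        ultimately show ?thesis using True by simp
      next
        case False
        then show ?thesis using value_near_mean[OF lip \<open>0 \<le> K\<close> elim(3,1) False] by simp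
      qed
    qed
    show "integrable M (\<lambda>\<omega>. K * deviation \<delta> j + 2 * C * indicator (deviates \<delta> j) \<omega>)"
      by (intro Bochner_Integration.integrable_add integrable_const integrable_mult_right ind)
  qed (use int in auto)
  also have "\<dots> = K * deviation \<delta> j + 2 * C * prob (deviates \<delta> j)"
    using ind by (subst Bochner_Integration.integral_add) (auto simp: prob_space)
  finally show "norm ((\<integral>\<omega>. ?g \<omega> \<partial>M) - f (real j / r)) \<le> K * deviation \<delta> j + 2 * C * prob (deviates \<delta> j)" .
qed

end

section \<open>The superposition\<close>

lemma (in prob_space) nn_integral_nat_valued:
  fixes f :: "nat \<Rightarrow> ennreal"
  assumes [measurable]: "Y \<in> measurable M (count_space UNIV)"
  shows "(\<integral>\<^sup>+\<omega>. f (Y \<omega>) \<partial>M) = (\<Sum>m. f m * emeasure M {\<omega> \<in> space M. Y \<omega> = m})"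
proof -
  have "(\<integral>\<^sup>+\<omega>. f (Y \<omega>) \<partial>M)
      = (\<integral>\<^sup>+\<omega>. (\<Sum>m. f m * indicator {\<omega> \<in> space M. Y \<omega> = m} \<omega>) \<partial>M)"
  proof (rule nn_integral_cong)
    fix \<omega> assume "\<omega> \<in> space M"
    then show "f (Y \<omega>) = (\<Sum>m. f m * indicator {\<omega> \<in> space M. Y \<omega> = m} \<omega>)"
      by (subst suminf_cmult_indicator[where i = "Y \<omega>"]) (auto simp: disjoint_family_on_def)
  qed
  also have "\<dots> = (\<Sum>m. \<integral>\<^sup>+\<omega>. f m * indicator {\<omega> \<in> space M. Y \<omega> = m} \<omega> \<partial>M)"
    by (intro nn_integral_suminf) measurable
  also have "\<dots> = (\<Sum>m. f m * emeasure M {\<omega> \<in> space M. Y \<omega> = m})"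
    by (simp add: nn_integral_cmult_indicator)
  finally show ?thesis .
qed

lemma poisson_process_mgf:
  assumes "prob_space M" and X: "poisson_process M r X" and "0 \<le> r" "0 \<le> t"
  shows "(\<integral>\<^sup>+\<omega>. ennreal (exp (\<theta> * real (X t \<omega>))) \<partial>M) = ennreal (exp (r * t * (exp \<theta> - 1)))"
proof -
  interpret prob_space M by fact
  have [measurable]: "X t \<in> measurable M (count_space UNIV)"
    using X \<open>0 \<le> t\<close> by (simp add: poisson_process_def)
  have law: "prob {\<omega> \<in> space M. X t \<omega> = m} = Poi (r * t) m" for m
  proof -
    have "prob {\<omega> \<in> space M. X t \<omega> - X 0 \<omega> = m} = Poi (r * (t - 0)) m"
      using X \<open>0 \<le> t\<close> unfolding poisson_process_def by blast
    moreover have "{\<omega> \<in> space M. X t \<omega> - X 0 \<omega> = m} = {\<omega> \<in> space M. X t \<omega> = m}"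
      using X by (auto simp: poisson_process_def)
    ultimately show ?thesis by simp
  qed
  have "(\<integral>\<^sup>+\<omega>. ennreal (exp (\<theta> * real (X t \<omega>))) \<partial>M)
      = (\<Sum>m. ennreal (exp (\<theta> * real m)) * emeasure M {\<omega> \<in> space M. X t \<omega> = m})"
    by (rule nn_integral_nat_valued[where f = "\<lambda>m. ennreal (exp (\<theta> * real m))"]) measurable
  also have "\<dots> = (\<Sum>m. ennreal (Poi (r * t) m * exp \<theta> ^ m))"
    using assms by (simp add: emeasure_eq_measure law ennreal_mult[symmetric] Poi_nonneg
        exp_of_nat_mult[symmetric] mult_ac)
  also have "\<dots> = ennreal (exp (r * t * (exp \<theta> - 1)))"
    using assms Poi_generating_function[of "r * t" "exp \<theta>"]
    by (intro suminf_ennreal_eq) (auto simp: Poi_nonneg)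
  finally show ?thesis .
qed

text \<open>
  By independence the exponential moments of the summands multiply, so that the rates \<open>l0\<close> and
  \<open>n - l0\<close> times 1 add up to \<open>n\<close>.
\<close>

lemma superposition_poisson_counting:
  assumes "prob_space M" and "0 < l0" "l0 \<le> n"
    and N: "poisson_process M (real l0) N"
    and N': "\<And>k. l0 + 1 \<le> k \<Longrightarrow> poisson_process M 1 (N' k)"
    and indep: "indep_processes M (\<lambda>k. if k = l0 then N else N' k) {l0..}"
  shows "poisson_counting M (superposition l0 N N' n) (real n)"
proof -
  interpret prob_space M by fact
  define Y where "Y k = (if k = l0 then N else N' k)" for k
  define \<rho> where "\<rho> k = (if k = l0 then real l0 else 1)" for k
  have Y: "poisson_process M (\<rho> k) (Y k)" if "l0 \<le> k" for k
    using that N N'[of k] by (auto simp: Y_def \<rho>_def)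
  have split: "{l0..n} = insert l0 {l0 + 1..n}" using \<open>l0 \<le> n\<close> by auto
  have sup: "superposition l0 N N' n t \<omega> = (\<Sum>k\<in>{l0..n}. Y k t \<omega>)" for t \<omega>
    unfolding superposition_def split by (simp add: Y_def)
  have rates: "(\<Sum>k\<in>{l0..n}. \<rho> k) = real n"
    unfolding split using \<open>l0 \<le> n\<close> by (simp add: \<rho>_def)
  have meas: "Y k t \<in> measurable M (count_space UNIV)" if "l0 \<le> k" "0 \<le> t" for k t
    using Y that by (simp add: poisson_process_def)
  show ?thesis
  proof unfold_locales
    show "0 < real n" using assms by simp
  next
    fix t :: real assume "0 \<le> t"
    then show "superposition l0 N N' n t \<in> measurable M (count_space UNIV)"
      unfolding sup[abs_def] using meas by (intro measurable_sum_nat) auto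
  next
    fix \<omega> and s t :: real assume "\<omega> \<in> space M" "0 \<le> s" "s \<le> t"
    then show "superposition l0 N N' n s \<omega> \<le> superposition l0 N N' n t \<omega>"
      unfolding sup using Y by (intro sum_mono) (auto simp: poisson_process_def mono_on_def)
  next
    fix t \<theta> :: real assume t: "0 \<le> t"
    have Y_indep: "indep_vars (\<lambda>_. Pi\<^sub>M {0::real..} (\<lambda>_. count_space (UNIV :: nat set)))
        (\<lambda>k \<omega>. \<lambda>t\<in>{0..}. Y k t \<omega>) {l0..n}"
      using indep unfolding indep_processes_def Y_def by (rule indep_vars_subset) auto
    have [measurable]: "(\<lambda>x. x t) \<in> measurable
        (Pi\<^sub>M {0::real..} (\<lambda>_. count_space (UNIV :: nat set))) (count_space UNIV)"
      by (rule measurable_component_singleton) (use t in auto)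
    have "indep_vars (\<lambda>_. borel)
        (\<lambda>k \<omega>. (\<lambda>x. ennreal (exp (\<theta> * real (x t)))) (\<lambda>t\<in>{0..}. Y k t \<omega>)) {l0..n}"
      by (rule indep_vars_compose2[OF Y_indep]) measurable
    then have ind: "indep_vars (\<lambda>_. borel) (\<lambda>k \<omega>. ennreal (exp (\<theta> * real (Y k t \<omega>)))) {l0..n}"
      using t by simp
    have "(\<integral>\<^sup>+\<omega>. ennreal (exp (\<theta> * real (superposition l0 N N' n t \<omega>))) \<partial>M)
        = (\<integral>\<^sup>+\<omega>. (\<Prod>k\<in>{l0..n}. ennreal (exp (\<theta> * real (Y k t \<omega>)))) \<partial>M)"
      by (simp add: sup sum_distrib_left exp_sum prod_ennreal)
    also have "\<dots> = (\<Prod>k\<in>{l0..n}. \<integral>\<^sup>+\<omega>. ennreal (exp (\<theta> * real (Y k t \<omega>))) \<partial>M)"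
      by (rule indep_vars_nn_integral[OF _ ind]) auto
    also have "\<dots> = (\<Prod>k\<in>{l0..n}. ennreal (exp (\<rho> k * t * (exp \<theta> - 1))))"
      by (intro prod.cong refl poisson_process_mgf \<open>prob_space M\<close> Y t) (auto simp: \<rho>_def)
    also have "\<dots> = ennreal (exp (\<Sum>k\<in>{l0..n}. \<rho> k * (t * (exp \<theta> - 1))))"
      by (simp add: prod_ennreal exp_sum mult_ac)
    also have "(\<Sum>k\<in>{l0..n}. \<rho> k * (t * (exp \<theta> - 1))) = real n * t * (exp \<theta> - 1)"
      unfolding sum_distrib_right[symmetric] rates by simp
    finally show "(\<integral>\<^sup>+\<omega>. ennreal (exp (\<theta> * real (superposition l0 N N' n t \<omega>))) \<partial>M)
        = ennreal (exp (real n * t * (exp \<theta> - 1)))" .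
  qed
qed

section \<open>Intensity matrix functions\<close>

text \<open>
  In each row the off-diagonal entries are nonnegative and sum to at most the exit rate.
\<close>

lemma intensity_matrix_function_bounded:
  fixes \<Lambda> :: "real \<Rightarrow> real^'p^'p"
  assumes "intensity_matrix_function \<Lambda>" and "bdd_above (exit_rates \<Lambda>)"
  obtains C where "\<And>x. 0 \<le> x \<Longrightarrow> norm (\<Lambda> x) \<le> C"
proof -
  obtain S where S: "\<And>y. y \<in> exit_rates \<Lambda> \<Longrightarrow> y \<le> S" using assms(2) by (auto simp: bdd_above_def)
  have "\<bar>\<Lambda> x $ i $ j\<bar> \<le> S" if x: "0 \<le> x" for x i j
  proof -
    have diag: "\<bar>\<Lambda> x $ i $ i\<bar> \<le> S" using S x by (auto simp: exit_rates_def)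
    show ?thesis
    proof (cases "i = j")
      case False
      have off: "0 \<le> \<Lambda> x $ i $ k" if "k \<noteq> i" for k
        using assms(1) x that by (auto simp: intensity_matrix_function_def)
      have "\<Lambda> x $ i $ j \<le> (\<Sum>k\<in>UNIV - {i}. \<Lambda> x $ i $ k)"
        using off False by (intro member_le_sum) auto
      also have "\<dots> = (\<Sum>k\<in>UNIV. \<Lambda> x $ i $ k) - \<Lambda> x $ i $ i" by (simp add: sum_diff1)
      also have "\<dots> \<le> - \<Lambda> x $ i $ i"
        using assms(1) x by (simp add: intensity_matrix_function_def)
      finally show ?thesis using off[of j] False diag by auto
    qed (use diag in simp)
  qed
  then have "norm (\<Lambda> x) \<le> (\<Sum>i\<in>(UNIV :: 'p set). \<Sum>j\<in>(UNIV :: 'p set). S)" if "0 \<le> x" for x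
    by (intro order_trans[OF norm_le_sum_entries] sum_mono) (use that in auto)
  then show ?thesis by (rule that)
qed

section \<open>Uniform comparison of the Poisson averages\<close>

lemma sup_dist_less:
  assumes "\<And>s t. 0 \<le> s \<Longrightarrow> s \<le> t \<Longrightarrow> t \<le> T \<Longrightarrow> norm (A s t - B s t) \<le> b" and "b < c"
  shows "sup_dist T A B < ereal c"
proof -
  have "sup_norm (A s t - B s t) \<le> b" if "0 \<le> s" "s < t" "t \<le> T" for s t
    using assms(1)[of s t] sup_norm_le_norm[of "A s t - B s t"] that by linarith
  then have "sup_dist T A B \<le> ereal b"
    unfolding sup_dist_def by (intro SUP_least) auto
  also have "ereal b < ereal c" using \<open>b < c\<close> by simp
  finally show ?thesis .
qed

text \<open>
  Here \<open>G\<close> is an arbitrary constant: the logarithm in the threshold dominates it even when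
  \<open>\<delta> = \<epsilon>\<close>.
\<close>

lemma eventually_deviation_conditions:
  fixes \<delta> \<epsilon> G T :: real
  assumes "0 < \<delta>" "\<delta> \<le> \<epsilon>" "0 \<le> T"
  shows "\<forall>\<^sub>F n :: nat in sequentially. 2 \<le> real n powr \<delta>
    \<and> exp (2 - real n powr \<delta>) \<le> real n powr (\<delta> - 1 / 2)
    \<and> G * real n powr (\<delta> - 1 / 2) < (T + 1) * ln (real n) * real n powr (- 1 / 2 + \<epsilon>)"
proof -
  have "\<forall>\<^sub>F n :: nat in sequentially. 2 \<le> real n powr \<delta>"
    using \<open>0 < \<delta>\<close> by real_asymp
  moreover have "\<forall>\<^sub>F n :: nat in sequentially. exp (2 - real n powr \<delta>) \<le> real n powr (- 1 / 2)"
    using \<open>0 < \<delta>\<close> by real_asymp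
  then have "\<forall>\<^sub>F n :: nat in sequentially. exp (2 - real n powr \<delta>) \<le> real n powr (\<delta> - 1 / 2)"
    using eventually_ge_at_top[of 1]
  proof eventually_elim
    case (elim n)
    have "real n powr (- 1 / 2) \<le> real n powr (\<delta> - 1 / 2)" using elim assms by (intro powr_mono) auto
    then show ?case using elim by linarith
  qed
  moreover have "\<forall>\<^sub>F n :: nat in sequentially. \<bar>G\<bar> < ln (real n)" by real_asymp
  then have "\<forall>\<^sub>F n :: nat in sequentially.
      G * real n powr (\<delta> - 1 / 2) < (T + 1) * ln (real n) * real n powr (- 1 / 2 + \<epsilon>)"
    using eventually_ge_at_top[of 1]
  proof eventually_elim
    case (elim n)
    have "G * real n powr (\<delta> - 1 / 2) < ln (real n) * real n powr (\<delta> - 1 / 2)"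
      using elim by (intro mult_strict_right_mono) auto
    also have "\<dots> \<le> ((T + 1) * ln (real n)) * real n powr (- 1 / 2 + \<epsilon>)"
      using assms elim mult_right_mono[of 1 "T + 1" "ln (real n)"]
      by (intro mult_mono powr_mono) auto
    finally show ?case .
  qed
  ultimately show ?thesis by eventually_elim auto
qed

text \<open>
  The sequence \<open>B\<close> stands for either of the deterministic sequences \<open>\<Lambda> (j / n)\<close> and
  \<open>\<integral>\<Lambda> (\<chi>\<^sub>j)\<close>. The cut-off \<open>n\<^sup>2\<close> is small enough for a union bound and large enough for
  the admitted deviation to be at least 1 beyond it.
\<close>

lemma (in poisson_counting) prob_large_sup_dist_le:
  fixes \<Lambda> :: "real \<Rightarrow> real^'p^'p"
  assumes r: "r = real n" and n: "1 \<le> n"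
    and \<delta>: "\<delta> \<le> 1 / 2" "2 \<le> r powr \<delta>" "0 < \<delta>"
    and C: "\<And>x. 0 \<le> x \<Longrightarrow> norm (\<Lambda> x) \<le> C"
    and lip: "\<And>x y. 0 \<le> x \<Longrightarrow> 0 \<le> y \<Longrightarrow> norm (\<Lambda> x - \<Lambda> y) \<le> K * \<bar>x - y\<bar>" and "0 \<le> K"
    and B: "\<And>j. norm (B j) \<le> C"
    and B_near: "\<And>j. norm (B j - \<Lambda> (real j / real n)) \<le> L * deviation \<delta> j" and "0 \<le> L"
    and \<Gamma>: "\<And>(A :: nat \<Rightarrow> real^'p^'p) \<eta> s t. 0 \<le> s \<Longrightarrow> s \<le> t \<Longrightarrow> t \<le> T \<Longrightarrow> (\<And>j. norm (A j) \<le> C) \<Longrightarrow>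
     (\<And>j. norm (A j - B j) \<le> \<eta> * (1 + real j / real n)) \<Longrightarrow>
     norm (poisson_series n (\<lambda>j. mat 1 + (1 / real n) *\<^sub>R A j) s t
         - poisson_series n (\<lambda>j. mat 1 + (1 / real n) *\<^sub>R B j) s t) \<le> \<Gamma> * \<eta>"
    and c: "\<Gamma> * (K + 2 * C + L) * r powr (\<delta> - 1 / 2) < c"
  shows "prob {\<omega> \<in> space M. ereal c \<le> sup_dist T
      (poisson_series n (\<lambda>j. mat 1 + (1 / real n) *\<^sub>R \<Lambda> (arrival_time X j \<omega>)))
      (poisson_series n (\<lambda>j. mat 1 + (1 / real n) *\<^sub>R B j))}
    \<le> 2 * (real n ^ 2 + 1) * exp (2 - real n powr \<delta>)" (is "prob ?E \<le> _")
proof -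
  have "0 \<le> C" using order_trans[OF norm_ge_zero C[of 0]] by simp
  have far: "1 \<le> deviation \<delta> j" if "n ^ 2 < j" for j
  proof -
    have "real (n ^ 2) \<le> real j" using that by linarith
    then have "r \<le> 1 + real j / r" using n r by (simp add: field_simps power2_eq_square)
    moreover have "1 / r \<le> r powr (\<delta> - 1 / 2)"
    proof -
      have "r powr (- 1) \<le> r powr (\<delta> - 1 / 2)" using \<delta> n r by (intro powr_mono) auto
      then show ?thesis using rate_pos by (simp add: powr_minus_divide)
    qed
    ultimately have "r * (1 / r) \<le> deviation \<delta> j"
      unfolding deviation_def using rate_pos by (intro mult_mono) auto
    then show ?thesis using rate_pos by simp
  qed
  define F where "F = (\<Union>j\<le>n ^ 2. deviates \<delta> j)"
  have [measurable]: "F \<in> sets M" unfolding F_def by measurable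
  have "AE \<omega> in M. \<omega> \<in> ?E \<longrightarrow> \<omega> \<in> F"
    using AE_reaches_all_levels AE_space
  proof eventually_elim
    case (elim \<omega>)
    have "sup_dist T (poisson_series n (\<lambda>j. mat 1 + (1 / real n) *\<^sub>R \<Lambda> (arrival_time X j \<omega>)))
        (poisson_series n (\<lambda>j. mat 1 + (1 / real n) *\<^sub>R B j)) < ereal c" if "\<omega> \<notin> F"
    proof (rule sup_dist_less[OF _ c])
      fix s t :: real assume st: "0 \<le> s" "s \<le> t" "t \<le> T"
      have A: "norm (\<Lambda> (arrival_time X j \<omega>)) \<le> C" for j
        using elim by (intro C arrival_time_nonneg) auto
      have "norm (\<Lambda> (arrival_time X j \<omega>) - B j)
          \<le> (K + 2 * C + L) * r powr (\<delta> - 1 / 2) * (1 + real j / real n)" for j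
      proof -
        have "norm (\<Lambda> (arrival_time X j \<omega>) - \<Lambda> (real j / real n)) \<le> (K + 2 * C) * deviation \<delta> j"
        proof (cases "j \<le> n ^ 2")
          case True
          then have "\<omega> \<notin> deviates \<delta> j" using that by (auto simp: F_def)
          then have "norm (\<Lambda> (arrival_time X j \<omega>) - \<Lambda> (real j / real n)) \<le> K * deviation \<delta> j"
            unfolding r[symmetric] using elim by (intro value_near_mean lip \<open>0 \<le> K\<close>) auto
          also have "\<dots> \<le> (K + 2 * C) * deviation \<delta> j"
            using \<open>0 \<le> C\<close> deviation_nonneg by (intro mult_right_mono) auto
          finally show ?thesis .
        next
          case False
          have "norm (\<Lambda> (arrival_time X j \<omega>) - \<Lambda> (real j / real n))
              \<le> norm (\<Lambda> (arrival_time X j \<omega>)) + norm (\<Lambda> (real j / real n))"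
            by (rule norm_triangle_ineq4)
          also have "\<dots> \<le> C + C" by (intro add_mono A C) simp
          also have "\<dots> \<le> (K + 2 * C) * 1" using \<open>0 \<le> K\<close> by simp
          also have "\<dots> \<le> (K + 2 * C) * deviation \<delta> j"
            using \<open>0 \<le> K\<close> \<open>0 \<le> C\<close> far[of j] False by (intro mult_left_mono) auto
          finally show ?thesis .
        qed
        then have "norm (\<Lambda> (arrival_time X j \<omega>) - B j) \<le> (K + 2 * C) * deviation \<delta> j + L * deviation \<delta> j"
          using B_near[of j] norm_triangle_ineq4[of "\<Lambda> (arrival_time X j \<omega>) - \<Lambda> (real j / real n)" "B j - \<Lambda> (real j / real n)"]
          by simp
        then have "norm (\<Lambda> (arrival_time X j \<omega>) - B j) \<le> (K + 2 * C + L) * deviation \<delta> j"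
          by (simp add: algebra_simps)
        then show ?thesis unfolding deviation_def unfolding r by (simp add: mult_ac)
      qed
      then show "norm (poisson_series n (\<lambda>j. mat 1 + (1 / real n) *\<^sub>R \<Lambda> (arrival_time X j \<omega>)) s t
         - poisson_series n (\<lambda>j. mat 1 + (1 / real n) *\<^sub>R B j) s t)
         \<le> \<Gamma> * (K + 2 * C + L) * r powr (\<delta> - 1 / 2)"
        using \<Gamma>[OF st A] by (simp add: mult.assoc)
    qed
    then show ?case by (auto simp: not_le[symmetric])
  qed
  \<comment> \<open>The supremum in \<open>?E\<close> is over uncountably many pairs. If \<open>?E\<close> is not measurable, its
    measure is 0 by convention, so the inequality holds in any case.\<close>
  then have "prob ?E \<le> prob F" by (rule finite_measure_mono_AE) measurable
  also have "\<dots> \<le> (\<Sum>j\<le>n ^ 2. prob (deviates \<delta> j))"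
    unfolding F_def by (rule finite_measure_subadditive_finite) auto
  also have "\<dots> \<le> (\<Sum>j\<le>n ^ 2. 2 * exp (2 - r powr \<delta>))"
    using n r \<delta> by (intro sum_mono prob_deviates_le) auto
  also have "\<dots> = 2 * (real n ^ 2 + 1) * exp (2 - real n powr \<delta>)"
    by (simp add: r algebra_simps)
  finally show ?thesis .
qed

theorem theorem4:
  fixes M :: "'a measure"
    and \<Lambda> :: "real \<Rightarrow> real^'p^'p"
    and N :: "real \<Rightarrow> 'a \<Rightarrow> nat"
    and N' :: "nat \<Rightarrow> real \<Rightarrow> 'a \<Rightarrow> nat"
  assumes "prob_space M"
    and "intensity_matrix_function \<Lambda>"
    and "bdd_above (exit_rates \<Lambda>)"
    and "0 < base_rate \<Lambda>"
    and "poisson_process M (real (base_rate \<Lambda>)) N"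
    and "\<And>k. base_rate \<Lambda> + 1 \<le> k \<Longrightarrow> poisson_process M 1 (N' k)"
    and "indep_processes M (\<lambda>k. if k = base_rate \<Lambda> then N else N' k) {base_rate \<Lambda>..}"
    and "\<exists>K>0. \<forall>x\<ge>0. \<forall>y\<ge>0. sup_norm (\<Lambda> x - \<Lambda> y) \<le> K * \<bar>x - y\<bar>"
  shows "\<forall>q>1. \<forall>\<epsilon>>0. \<exists>\<kappa>::real. \<forall>T\<ge>0.
    (\<lambda>n. measure M {\<omega> \<in> space M.
        ereal ((T + 1) * \<kappa> * ln (real n) * real n powr (- 1 / 2 + \<epsilon>))
          \<le> sup_dist T (P_random \<Lambda> N N' n \<omega>) (P_hat \<Lambda> n)})
      \<in> o(\<lambda>n. real n powr (- q)) \<and>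
    (\<lambda>n. measure M {\<omega> \<in> space M.
        ereal ((T + 1) * \<kappa> * ln (real n) * real n powr (- 1 / 2 + \<epsilon>))
          \<le> sup_dist T (P_random \<Lambda> N N' n \<omega>) (P_tilde M \<Lambda> N N' n)})
      \<in> o(\<lambda>n. real n powr (- q))"
proof (intro allI impI exI[of _ 1])
  fix q \<epsilon> T :: real
  assume "1 < q" "0 < \<epsilon>" "0 \<le> T"
  define l0 where "l0 = base_rate \<Lambda>"
  obtain C where C: "\<And>x. 0 \<le> x \<Longrightarrow> norm (\<Lambda> x) \<le> C"
    using intensity_matrix_function_bounded[OF assms(2,3)] by blast
  have "0 \<le> C" using order_trans[OF norm_ge_zero C[of 0]] by simp
  have \<Lambda>_meas: "\<Lambda> \<in> borel_measurable (restrict_space borel {0..})"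
    using assms(2) by (simp add: intensity_matrix_function_def)
  obtain K' where "K' > 0" and K': "\<And>x y. 0 \<le> x \<Longrightarrow> 0 \<le> y \<Longrightarrow> sup_norm (\<Lambda> x - \<Lambda> y) \<le> K' * \<bar>x - y\<bar>"
    using assms(8) by blast
  define K where "K = (real CARD('p))\<^sup>2 * K'"
  have "0 \<le> K" using \<open>K' > 0\<close> by (simp add: K_def)
  have lip: "norm (\<Lambda> x - \<Lambda> y) \<le> K * \<bar>x - y\<bar>" if "0 \<le> x" "0 \<le> y" for x y
    unfolding K_def mult.assoc
    by (rule order_trans[OF norm_le_sup_norm mult_left_mono[OF K'[OF that]]]) simp
  obtain \<Gamma> where \<Gamma>: "\<And>n (A :: nat \<Rightarrow> real^'p^'p) B \<eta> s t. 1 \<le> n \<Longrightarrow> 0 \<le> s \<Longrightarrow> s \<le> t \<Longrightarrow> t \<le> T \<Longrightarrow>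
     (\<And>j. norm (A j) \<le> C) \<Longrightarrow> (\<And>j. norm (B j) \<le> C) \<Longrightarrow>
     (\<And>j. norm (A j - B j) \<le> \<eta> * (1 + real j / real n)) \<Longrightarrow>
     norm (poisson_series n (\<lambda>j. mat 1 + (1 / real n) *\<^sub>R A j) s t
         - poisson_series n (\<lambda>j. mat 1 + (1 / real n) *\<^sub>R B j) s t) \<le> \<Gamma> * \<eta>"
    using poisson_series_diff_le[where 'p = 'p, of T C] by metis
  define \<delta> where "\<delta> = min \<epsilon> (1 / 2)"
  have \<delta>: "0 < \<delta>" "\<delta> \<le> \<epsilon>" "\<delta> \<le> 1 / 2" using \<open>0 < \<epsilon>\<close> by (auto simp: \<delta>_def)
  \<comment> \<open>The constant for the expectations; \<open>4 * C\<close> comes from the event that the arrival time deviates.\<close>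
  define L where "L = K + 4 * C"
  have "0 \<le> L" using \<open>0 \<le> K\<close> \<open>0 \<le> C\<close> by (simp add: L_def)
  \<comment> \<open>The factor 1 is \<open>\<kappa>\<close>.\<close>
  define thr where "thr n = (T + 1) * 1 * ln (real n) * real n powr (- 1 / 2 + \<epsilon>)" for n :: nat
  define rhs where "rhs n = 2 * (real n ^ 2 + 1) * exp (2 - real n powr \<delta>)" for n :: nat
  have bounds: "\<forall>\<^sub>F n in sequentially.
      measure M {\<omega> \<in> space M. ereal (thr n) \<le> sup_dist T (P_random \<Lambda> N N' n \<omega>) (P_hat \<Lambda> n)} \<le> rhs n
    \<and> measure M {\<omega> \<in> space M. ereal (thr n) \<le> sup_dist T (P_random \<Lambda> N N' n \<omega>) (P_tilde M \<Lambda> N N' n)} \<le> rhs n"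
    using eventually_ge_at_top[of "max 1 l0"]
      eventually_deviation_conditions[OF \<delta>(1,2) \<open>0 \<le> T\<close>, of "\<Gamma> * (K + 2 * C + L)"]
  proof eventually_elim
    case (elim n)
    then have n: "1 \<le> n" "l0 \<le> n" and pow: "2 \<le> real n powr \<delta>"
      and small: "exp (2 - real n powr \<delta>) \<le> real n powr (\<delta> - 1 / 2)"
      and thr: "\<Gamma> * (K + 2 * C + L) * real n powr (\<delta> - 1 / 2) < thr n"
      by (auto simp: thr_def)
    interpret poisson_counting M "superposition l0 N N' n" "real n"
      unfolding l0_def using assms n by (intro superposition_poisson_counting) (auto simp: l0_def)
    have chi: "chi \<Lambda> N N' n = arrival_time (superposition l0 N N' n)" by (simp add: chi_def l0_def)
    note bound = prob_large_sup_dist_le[OF refl n(1) \<delta>(3) pow \<delta>(1) C lip \<open>0 \<le> K\<close> _ _ \<open>0 \<le> L\<close> \<Gamma>[OF n(1)] thr,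
        folded rhs_def]
    have "0 \<le> L * deviation \<delta> j" for j using \<open>0 \<le> L\<close> deviation_nonneg by simp
    then have "measure M {\<omega> \<in> space M. ereal (thr n) \<le> sup_dist T (P_random \<Lambda> N N' n \<omega>) (P_hat \<Lambda> n)} \<le> rhs n"
      unfolding P_random_def P_hat_def chi by (intro bound) (auto intro!: C)
    moreover
    define E where "E j = (\<integral>\<omega>. \<Lambda> (arrival_time (superposition l0 N N' n) j \<omega>) \<partial>M)" for j
    have E: "norm (E j) \<le> C" for j
      unfolding E_def by (rule expectation_near_mean(1)[OF \<Lambda>_meas C lip \<open>0 \<le> K\<close>])
    have E_near: "norm (E j - \<Lambda> (real j / real n)) \<le> L * deviation \<delta> j" for j
    proof -
      have "norm (E j - \<Lambda> (real j / real n)) \<le> K * deviation \<delta> j + 2 * C * prob (deviates \<delta> j)"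
        unfolding E_def by (rule expectation_near_mean(2)[OF \<Lambda>_meas C lip \<open>0 \<le> K\<close>])
      moreover have "prob (deviates \<delta> j) \<le> 2 * deviation \<delta> j"
      proof -
        have "prob (deviates \<delta> j) \<le> 2 * exp (2 - real n powr \<delta>)"
          using n \<delta> pow by (intro prob_deviates_le) auto
        also have "exp (2 - real n powr \<delta>) \<le> 1 * real n powr (\<delta> - 1 / 2)" using small by simp
        also have "\<dots> \<le> deviation \<delta> j"
          unfolding deviation_def by (intro mult_right_mono) auto
        finally show ?thesis by simp
      qed
      then have "2 * C * prob (deviates \<delta> j) \<le> 2 * C * (2 * deviation \<delta> j)"
        using \<open>0 \<le> C\<close> by (intro mult_left_mono) auto
      ultimately show ?thesis by (simp add: L_def algebra_simps)
    qed
    have "measure M {\<omega> \<in> space M. ereal (thr n) \<le> sup_dist T (P_random \<Lambda> N N' n \<omega>) (P_tilde M \<Lambda> N N' n)} \<le> rhs n"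
      unfolding P_random_def P_tilde_def chi E_def[symmetric] by (intro bound E E_near) auto
    ultimately show ?case by blast
  qed
  have rhs: "rhs \<in> o(\<lambda>n. real n powr (- q))"
    unfolding rhs_def using \<delta>(1) by real_asymp
  have negligible: "f \<in> o(\<lambda>n. real n powr (- q))"
    if "\<forall>\<^sub>F n in sequentially. f n \<le> rhs n" and "\<And>n. 0 \<le> f n" for f :: "nat \<Rightarrow> real"
  proof (rule landau_o.big_small_trans[OF bigoI[where c = 1] rhs])
    show "\<forall>\<^sub>F n in sequentially. norm (f n) \<le> 1 * norm (rhs n)"
      using that(1)
    proof eventually_elim
      case (elim n)
      then show ?case using that(2)[of n] unfolding real_norm_def by linarith
    qed
  qed
  show "(\<lambda>n. measure M {\<omega> \<in> space M.
        ereal ((T + 1) * 1 * ln (real n) * real n powr (- 1 / 2 + \<epsilon>))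
          \<le> sup_dist T (P_random \<Lambda> N N' n \<omega>) (P_hat \<Lambda> n)})
      \<in> o(\<lambda>n. real n powr (- q)) \<and>
    (\<lambda>n. measure M {\<omega> \<in> space M.
        ereal ((T + 1) * 1 * ln (real n) * real n powr (- 1 / 2 + \<epsilon>))
          \<le> sup_dist T (P_random \<Lambda> N N' n \<omega>) (P_tilde M \<Lambda> N N' n)})
      \<in> o(\<lambda>n. real n powr (- q))"
    unfolding thr_def[symmetric]
    using bounds[unfolded eventually_conj_iff, THEN conjunct1]
      bounds[unfolded eventually_conj_iff, THEN conjunct2]
    by (intro conjI negligible measure_nonneg)
qed

end
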